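(* For each integer $g\ge1$ there exists an integral Apollonian super-packing with divisor $g$. The associated geometric super-packing is unique up to a Euclidean motion: any two geometric super-packings generated by integral Descartes configurations of divisor $g$ are images of each other under a Euclidean motion of the plane.
   Context: Circles are taken in $\hat{\mathbb C}=\mathbb R^2\cup\{\infty\}$; lines count as circles. A Descartes configuration is a set of four mutually tangent circles with disjoint interiors. An ordered, oriented Descartes configuration carries an ordering of its circles and a total orientation; its circles have signed curvatures (reciprocal radius, negative for a circle whose interior is unbounded, $0$ for lines, all signs reversed for negative orientation). Its curvature-center coordinate matrix $M_{\mathcal D}$ is the $4\times 3$ matrix with $i$-th row $(b_i,b_ix_i,b_iy_i)$, where $b_i$ is the signed curvature and $(x_i,y_i)$ the center of the $i$-th circle (for a line: $(0,n_x,n_y)$ with $n$ the unit normal pointing into the line's interior half-plane). Let $S_i$ be the $4\times4$ integer matrix equal to the identity except that row $i$ has $-1$ in position $i$ and $2$ in the other positions, $S_i^\perp=S_i^T$, and let the super-Apollonian group be $\mathcal A^S=\langle S_1,\dots,S_4,S_1^\perp,\dots,S_4^\perp\rangle$; it acts on ordered oriented Descartes configurations with $M_{U[\mathcal D]}=UM_{\mathcal D}$ (more precisely on the augmented $4\times4$ coordinates by left multiplication). The Apollonian super-packing generated by $\mathcal D$ is the orbit $\mathcal A^S[\mathcal D]$, and the geometric super-packing is the set of all circles of configurations in it. A super-packing is integral if one (equivalently every) configuration in it has integer curvatures; its divisor is the gcd of the four curvatures of any configuration in it (this is independent of the configuration). *)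

theory Defs
  imports "HOL-Analysis.Analysis"
begin

text \<open>Points of the plane are complex numbers z (x = Re z, y = Im z).
  A point of the Riemann sphere is a complex option (None = infinity).\<close>

text \<open>An oriented circle is described by its interior ("generalized disk"):
  Disk c r: the open disk of centre c and radius r (r > 0);
  CoDisk c r: the complement of the closed disk (unbounded interior);
  Half n d: the open half-plane of points z with inner product n . z > d,
  where n is a unit normal pointing into the interior.\<close>

datatype gdisk = Disk complex real | CoDisk complex real | Half complex real

fun gdisk_wf :: "gdisk \<Rightarrow> bool" where
  "gdisk_wf (Disk c r) = (r > 0)"
| "gdisk_wf (CoDisk c r) = (r > 0)"
| "gdisk_wf (Half n d) = (norm n = 1)"

fun gdisk_interior :: "gdisk \<Rightarrow> complex set" where
  "gdisk_interior (Disk c r) = ball c r"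
| "gdisk_interior (CoDisk c r) = - cball c r"
| "gdisk_interior (Half n d) = {z. n \<bullet> z > d}"

fun gcircle :: "gdisk \<Rightarrow> complex set" where
  "gcircle (Disk c r) = sphere c r"
| "gcircle (CoDisk c r) = sphere c r"
| "gcircle (Half n d) = {z. n \<bullet> z = d}"

fun gcircle_hat :: "gdisk \<Rightarrow> complex option set" where
  "gcircle_hat (Half n d) = insert None (Some ` gcircle (Half n d))"
| "gcircle_hat C = Some ` gcircle C"

definition tangent :: "gdisk \<Rightarrow> gdisk \<Rightarrow> bool" where
  "tangent C D \<longleftrightarrow> card (gcircle_hat C \<inter> gcircle_hat D) = 1"

fun gcurv :: "gdisk \<Rightarrow> real" where
  "gcurv (Disk c r) = 1 / r"
| "gcurv (CoDisk c r) = - 1 / r"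
| "gcurv (Half n d) = 0"

text \<open>Augmented curvature-center coordinates (bbar, b, b x, b y) of a positively
  oriented circle, where bbar = b |centre|^2 - 1/b is the curvature of the image
  under inversion in the unit circle; for the half-plane n . z > d it is 2 d.\<close>
fun aug_row :: "gdisk \<Rightarrow> real^4" where
  "aug_row (Disk c r) = vector [(norm c ^ 2 - r ^ 2) / r, 1 / r, Re c / r, Im c / r]"
| "aug_row (CoDisk c r) = vector [- (norm c ^ 2 - r ^ 2) / r, - 1 / r, - Re c / r, - Im c / r]"
| "aug_row (Half n d) = vector [2 * d, 0, Re n, Im n]"

text \<open>An ordered oriented Descartes configuration: an orientation sign
  (True = positive) together with an ordered quadruple of mutually tangent circles
  with pairwise disjoint interiors (indexed by the 4-element type 4).  With negative
  orientation all interiors are replaced by their complements, i.e. all signed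
  curvatures (and all coordinate rows) change sign.\<close>
type_synonym oodc = "bool \<times> (4 \<Rightarrow> gdisk)"

definition orient_sign :: "bool \<Rightarrow> real" where
  "orient_sign p = (if p then 1 else -1)"

definition is_oodc :: "oodc \<Rightarrow> bool" where
  "is_oodc X \<longleftrightarrow> (\<forall>i. gdisk_wf (snd X i)) \<and>
     (\<forall>i j. i \<noteq> j \<longrightarrow> gdisk_interior (snd X i) \<inter> gdisk_interior (snd X j) = {}
                       \<and> tangent (snd X i) (snd X j))"

definition curvature :: "oodc \<Rightarrow> 4 \<Rightarrow> real" where
  "curvature X i = orient_sign (fst X) * gcurv (snd X i)"

definition ccmatrix :: "oodc \<Rightarrow> real^3^4" where
  "ccmatrix X = (\<chi> i. orient_sign (fst X) *\<^sub>R vector [aug_row (snd X i) $ 2, aug_row (snd X i) $ 3, aug_row (snd X i) $ 4])"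

definition augmatrix :: "oodc \<Rightarrow> real^4^4" where
  "augmatrix X = (\<chi> i. orient_sign (fst X) *\<^sub>R aug_row (snd X i))"

definition Smat :: "4 \<Rightarrow> real^4^4" where
  "Smat i = (\<chi> r c. if r = i then (if c = i then -1 else 2) else (if r = c then 1 else 0))"

definition Sperp :: "4 \<Rightarrow> real^4^4" where
  "Sperp i = transpose (Smat i)"

text \<open>Group generated by the S_i and S_i^perp. Every generator is an involution,
  so the generated group is the set of all finite products of generators.\<close>
inductive_set superApollonian :: "(real^4^4) set" where
  id: "mat 1 \<in> superApollonian"
| S: "U \<in> superApollonian \<Longrightarrow> Smat i ** U \<in> superApollonian"
| Sp: "U \<in> superApollonian \<Longrightarrow> Sperp i ** U \<in> superApollonian"

definition super_packing :: "oodc \<Rightarrow> oodc set" where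
  "super_packing X = {Y. is_oodc Y \<and> (\<exists>U \<in> superApollonian. augmatrix Y = U ** augmatrix X)}"

definition geometric_super_packing :: "oodc \<Rightarrow> complex set set" where
  "geometric_super_packing X = {gcircle (snd Y i) | Y i. Y \<in> super_packing X}"

definition integral_conf :: "oodc \<Rightarrow> bool" where
  "integral_conf X \<longleftrightarrow> (\<forall>i. curvature X i \<in> \<int>)"

definition conf_divisor :: "oodc \<Rightarrow> int" where
  "conf_divisor X = Gcd ((\<lambda>i. \<lfloor>curvature X i\<rfloor>) ` UNIV)"

definition euclidean_motion :: "(complex \<Rightarrow> complex) \<Rightarrow> bool" where
  "euclidean_motion T \<longleftrightarrow> (\<forall>z w. dist (T z) (T w) = dist z w)"

end

theory Submission
  imports Defs
begin

text \<open>The coordinate rows of a Descartes configuration have Gram matrix \<open>2 I - J\<close> with respect to a Lorentz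
  form, and the generators of the super-Apollonian group preserve this property. Hence the curvatures always satisfy
  \<open>2 * (\<Sum> b i ^ 2) = (\<Sum> b i) ^ 2\<close>. As long as some curvature is negative or exceeds half of the sum,
  a generator replaces an integral quadruple of positive sum by one of smaller, still positive, sum. The descent
  stops at a permutation of \<open>(0, 0, g, g)\<close>, where \<open>g\<close> is the divisor because the gcd is invariant.
  The Gram relations determine a configuration with these curvatures up to a Euclidean motion, and the set of
  circles of a packing is equivariant under motions and does not change under the group, under relabelling, or
  under reversal of orientation.

  Packings are handled through arbitrary coordinate matrices \<open>W\<close>, only the realizable members of the
  orbit of \<open>W\<close> contributing circles. The matrices met in the descent therefore need not
  be shown to come from configurations.\<close>

subsection \<open>The Lorentz form and tangency\<close>

lemma vector_4 [simp]:
  "vector [w, x, y, z] $ (1::4) = w" "vector [w, x, y, z] $ (2::4) = x"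
  "vector [w, x, y, z] $ (3::4) = y" "vector [w, x, y, z] $ (4::4) = z"
  unfolding vector_def by simp_all

text \<open>On coordinate rows of circles with disjoint interiors this form takes the value 1 on equal and
  \<open>-1\<close> on tangent circles.\<close>

definition lorentz :: "real^4 \<Rightarrow> real^4 \<Rightarrow> real" where
  "lorentz u v = u$3 * v$3 + u$4 * v$4 - (u$1 * v$2 + u$2 * v$1) / 2"

lemma lorentz_sym: "lorentz u v = lorentz v u"
  by (simp add: lorentz_def algebra_simps)

lemma lorentz_uminus [simp]: "lorentz (- u) (- v) = lorentz u v"
  by (simp add: lorentz_def)

definition descartes_gram :: "real^4^4 \<Rightarrow> bool" where
  "descartes_gram W \<longleftrightarrow> (\<forall>i j. lorentz (W$i) (W$j) = (if i = j then 1 else -1))"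

lemma complex_inner_eq: "z \<bullet> w = Re z * Re w + Im z * Im w"
  by (simp add: inner_complex_def)

lemma lorentz_aug_row_self: "gdisk_wf C \<Longrightarrow> lorentz (aug_row C) (aug_row C) = 1"
proof (cases C)
  case (Disk c r)
  assume "gdisk_wf C"
  with Disk have "r > 0" by simp
  then show ?thesis
    unfolding Disk
    unfolding aug_row.simps lorentz_def vector_4 cmod_power2
    by (simp add: field_simps power2_eq_square)
next
  case (CoDisk c r)
  assume "gdisk_wf C"
  with CoDisk have "r > 0" by simp
  then show ?thesis
    unfolding CoDisk
    unfolding aug_row.simps lorentz_def vector_4 cmod_power2
    by (simp add: field_simps power2_eq_square)
next
  case (Half n d)
  assume "gdisk_wf C"
  with Half have "(cmod n)\<^sup>2 = 1" by simp
  then show ?thesis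
    unfolding Half cmod_power2 by (simp add: lorentz_def power2_eq_square)
qed

section \<open>Tangency of circles with disjoint interiors, case by case\<close>

lemma disjoint_balls_dist:
  fixes c c' :: complex
  assumes "r > 0" "s > 0" "ball c r \<inter> ball c' s = {}"
  shows "dist c c' \<ge> r + s"
proof (rule ccontr)
  assume a: "\<not> ?thesis"
  \<comment> \<open>This point divides the segment between the centres in the ratio
    \<open>r : s\<close>. Centres closer than \<open>r + s\<close> would put it in both
    balls.\<close>
  define z where "z = c + (r / (r + s)) *\<^sub>R (c' - c)"
  have "z - c = (r / (r + s)) *\<^sub>R (c' - c)" by (simp add: z_def)
  then have 1: "dist c z = r / (r + s) * dist c c'"
    using assms by (subst dist_commute) (simp add: dist_norm norm_minus_commute[of c])
  have "c' - z = (1 - r / (r + s)) *\<^sub>R (c' - c)" by (simp add: z_def algebra_simps)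
  also have "1 - r / (r + s) = s / (r + s)" using assms by (simp add: field_simps)
  finally have 2: "dist c' z = s / (r + s) * dist c c'"
    using assms by (simp add: dist_norm norm_minus_commute)
  have "dist c z < r" "dist c' z < s"
    using a assms mult_strict_left_mono[of "dist c c'" "r + s" r]
      mult_strict_left_mono[of "dist c c'" "r + s" s]
    unfolding 1 2 by (simp_all add: field_simps)
  with assms(3) show False by auto
qed

lemma tangent_imp_meet: "tangent C D \<Longrightarrow> gcircle_hat C \<inter> gcircle_hat D \<noteq> {}"
  by (auto simp: tangent_def)

lemma tangent_sym: "tangent C D \<longleftrightarrow> tangent D C"
  by (simp add: tangent_def Int_commute)

lemma lorentz_Disk_Disk:
  assumes "r > 0" "s > 0"
  shows "lorentz (aug_row (Disk c r)) (aug_row (Disk c' s)) = (r\<^sup>2 + s\<^sup>2 - (dist c c')\<^sup>2) / (2 * r * s)"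
proof -
  have "lorentz (aug_row (Disk c r)) (aug_row (Disk c' s)) =
    (2 * (Re c * Re c' + Im c * Im c') - ((cmod c)\<^sup>2 - r\<^sup>2) - ((cmod c')\<^sup>2 - s\<^sup>2)) / (2 * r * s)"
    using assms by (simp add: lorentz_def divide_simps)
  also have "2 * (Re c * Re c' + Im c * Im c') - ((cmod c)\<^sup>2 - r\<^sup>2) - ((cmod c')\<^sup>2 - s\<^sup>2) = r\<^sup>2 + s\<^sup>2 - (dist c c')\<^sup>2"
    unfolding dist_norm cmod_power2 by (simp add: power2_eq_square algebra_simps)
  finally show ?thesis .
qed

lemma aug_row_CoDisk: "aug_row (CoDisk c r) = - aug_row (Disk c r)"
proof -
  have 1: "aug_row (CoDisk c r) $ 1 = - aug_row (Disk c r) $ 1"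
    by simp (metis minus_diff_eq minus_divide_left)
  have 2: "aug_row (CoDisk c r) $ 2 = - aug_row (Disk c r) $ 2"
    by simp
  have 3: "aug_row (CoDisk c r) $ 3 = - aug_row (Disk c r) $ 3"
    by simp
  have 4: "aug_row (CoDisk c r) $ 4 = - aug_row (Disk c r) $ 4"
    by simp
  show ?thesis unfolding vec_eq_iff forall_4 vector_uminus_component using 1 2 3 4 by blast
qed

lemma lorentz_uminus_left: "lorentz (- u) v = - lorentz u v"
  by (simp add: lorentz_def diff_divide_distrib add_divide_distrib)

lemma lorentz_Half_Disk:
  assumes "r > 0"
  shows "lorentz (aug_row (Half n d)) (aug_row (Disk c r)) = (n \<bullet> c - d) / r"
  using assms by (simp add: lorentz_def inner_complex_def field_simps)

text \<open>The pattern of all cases involving a disk: disjointness gives one inequality for the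
  position of the centres, a common boundary point gives the opposite one, and the resulting
  equality makes the Lorentz product \<open>-1\<close>.\<close>

lemma tangent_Disk_Disk:
  assumes "r > 0" "s > 0" and int: "ball c r \<inter> ball c' s = {}" and "tangent (Disk c r) (Disk c' s)"
  shows "lorentz (aug_row (Disk c r)) (aug_row (Disk c' s)) = -1"
proof -
  have "dist c c' \<ge> r + s" by (rule disjoint_balls_dist) fact+
  moreover have "sphere c r \<inter> sphere c' s \<noteq> {}"
    using tangent_imp_meet[OF assms(4)] by auto
  then obtain z where "dist c z = r" "dist c' z = s"
    by (metis disjoint_iff mem_sphere)
  then have "dist c c' \<le> r + s" by metric
  ultimately have "dist c c' = r + s" by simp
  with assms show ?thesis
    unfolding lorentz_Disk_Disk[OF assms(1,2)] by (simp add: field_simps power2_eq_square)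
qed

lemma tangent_CoDisk_Disk:
  assumes "r > 0" "s > 0" and int: "(- cball c r) \<inter> ball c' s = {}" and "tangent (CoDisk c r) (Disk c' s)"
  shows "lorentz (aug_row (CoDisk c r)) (aug_row (Disk c' s)) = -1"
proof -
  have "ball c' s \<subseteq> cball c r" using int by blast
  then have "dist c' c + s \<le> r" using assms by (simp add: ball_subset_cball_iff)
  moreover have "sphere c r \<inter> sphere c' s \<noteq> {}"
    using tangent_imp_meet[OF assms(4)] by auto
  then obtain z where "dist c z = r" "dist c' z = s"
    by (metis disjoint_iff mem_sphere)
  then have "r \<le> dist c c' + s" by metric
  ultimately have d: "dist c c' = r - s" by (simp add: dist_commute)
  show ?thesis using assms(1,2)
    unfolding aug_row_CoDisk lorentz_uminus_left lorentz_Disk_Disk[OF assms(1,2)] d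
    by (simp add: field_simps power2_eq_square)
qed

text \<open>Two bounded disks cannot cover the plane. This excludes pairs of exteriors from a
  configuration.\<close>

lemma CoDisk_CoDisk_meet:
  fixes c c' :: complex
  shows "(- cball c r) \<inter> (- cball c' s) \<noteq> {}"
proof
  assume "(- cball c r) \<inter> (- cball c' s) = {}"
  then have "(UNIV :: complex set) = cball c r \<union> cball c' s" by blast
  then have "bounded (UNIV :: complex set)" by (metis bounded_Un bounded_cball)
  then show False by simp
qed

lemma tangent_Half_Disk:
  assumes "r > 0" "norm n = 1" and int: "{z. n \<bullet> z > d} \<inter> ball c r = {}"
    and "tangent (Half n d) (Disk c r)"
  shows "lorentz (aug_row (Half n d)) (aug_row (Disk c r)) = -1"
proof -
  have nn: "n \<bullet> n = 1" using assms(2) by (simp add: norm_eq_1)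
  \<comment> \<open>The extreme point \<open>c + r *\<^sub>R n\<close> is not in the open ball, so
    the bound is proved at every level \<open>s\<close> below it. The maximum with 0 makes
    \<open>s'\<close> a legitimate distance from the centre.\<close>
  have "n \<bullet> c + r \<le> d"
  proof (rule dense_le)
    fix s assume s: "s < n \<bullet> c + r"
    define s' where "s' = max 0 (s - n \<bullet> c)"
    have s': "0 \<le> s'" "s' < r" "s \<le> n \<bullet> c + s'" using s assms(1) by (auto simp: s'_def)
    then have "c + s' *\<^sub>R n \<in> ball c r" using assms(2) by (simp add: dist_norm)
    then have "n \<bullet> (c + s' *\<^sub>R n) \<le> d" using int by force
    then show "s \<le> d" using s' nn by (simp add: inner_add_right)
  qed
  moreover have "{z. n \<bullet> z = d} \<inter> sphere c r \<noteq> {}"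
    using tangent_imp_meet[OF assms(4)] by auto
  then obtain z where "z \<in> {z. n \<bullet> z = d} \<inter> sphere c r" by blast
  then have z: "dist c z = r" "n \<bullet> z = d" by simp_all
  have "n \<bullet> (z - c) \<le> norm n * norm (z - c)" by (rule norm_cauchy_schwarz)
  then have "d \<le> n \<bullet> c + r" using z assms(2)
    by (simp add: inner_diff_right dist_norm norm_minus_commute)
  ultimately have "n \<bullet> c = d - r" by simp
  with assms show ?thesis by (simp add: lorentz_Half_Disk del: aug_row.simps)
qed

lemma Half_CoDisk_meet:
  assumes "norm n = 1"
  shows "{z. n \<bullet> z > d} \<inter> (- cball c r) \<noteq> {}"
proof -
  have nn: "n \<bullet> n = 1" using assms by (simp add: norm_eq_1)
  define s where "s = \<bar>d - n \<bullet> c\<bar> + \<bar>r\<bar> + 1"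
  have "c + s *\<^sub>R n \<in> {z. n \<bullet> z > d} \<inter> (- cball c r)"
    using assms nn by (auto simp: s_def inner_add_right dist_norm)
  then show ?thesis by blast
qed

text \<open>Disjoint half-planes have opposite normals: otherwise a point far out in the direction
  \<open>n + n'\<close> lies in both.\<close>

lemma tangent_Half_Half:
  assumes n: "norm n = 1" "norm n' = 1" and int: "{z. n \<bullet> z > d} \<inter> {z. n' \<bullet> z > d'} = {}"
  shows "lorentz (aug_row (Half n d)) (aug_row (Half n' d')) = -1"
proof -
  have nn: "n \<bullet> n = 1" "n' \<bullet> n' = 1" using n by (simp_all add: norm_eq_1)
  have "\<bar>n \<bullet> n'\<bar> \<le> 1" using Cauchy_Schwarz_ineq2[of n n'] n by simp
  moreover have "\<not> 1 + n \<bullet> n' > 0"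
  proof
    assume pos: "1 + n \<bullet> n' > 0"
    \<comment> \<open>Chosen so that both inner products below equal
      \<open>\<bar>d\<bar> + \<bar>d'\<bar> + 1\<close>, which exceeds \<open>d\<close> and
      \<open>d'\<close>.\<close>
    define s where "s = (\<bar>d\<bar> + \<bar>d'\<bar> + 1) / (1 + n \<bullet> n')"
    have s: "s * (1 + n \<bullet> n') = \<bar>d\<bar> + \<bar>d'\<bar> + 1" using pos by (simp add: s_def)
    have "n \<bullet> (s *\<^sub>R (n + n')) = s * (1 + n \<bullet> n')" "n' \<bullet> (s *\<^sub>R (n + n')) = s * (1 + n \<bullet> n')"
      using nn by (simp_all add: inner_add_right inner_commute algebra_simps)
    then have "s *\<^sub>R (n + n') \<in> {z. n \<bullet> z > d} \<inter> {z. n' \<bullet> z > d'}" unfolding s by auto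
    then show False using int by blast
  qed
  ultimately have "n \<bullet> n' = -1" by linarith
  then show ?thesis by (simp add: lorentz_def inner_complex_def)
qed

lemma lorentz_tangent:
  assumes "gdisk_wf C" "gdisk_wf D" "gdisk_interior C \<inter> gdisk_interior D = {}" "tangent C D"
  shows "lorentz (aug_row C) (aug_row D) = -1"
proof -
  have sym: "gdisk_interior D \<inter> gdisk_interior C = {}" "tangent D C"
    using assms by (auto simp: tangent_sym)
  show ?thesis
  proof (cases C)
    case C: (Disk c r)
    show ?thesis
    proof (cases D)
      case (Disk c' s)
      with C assms show ?thesis
        using tangent_Disk_Disk[of r s c c'] by (simp del: aug_row.simps)
    next
      case (CoDisk c' s)
      with C assms sym have "lorentz (aug_row D) (aug_row C) = -1"
        using tangent_CoDisk_Disk[of s r c' c] by (simp del: aug_row.simps)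
      then show ?thesis by (subst lorentz_sym)
    next
      case (Half n d)
      with C assms sym have "lorentz (aug_row D) (aug_row C) = -1"
        using tangent_Half_Disk[of r n d c] by (simp del: aug_row.simps)
      then show ?thesis by (subst lorentz_sym)
    qed
  next
    case C: (CoDisk c r)
    then have "\<exists>c' s. D = Disk c' s"
      using assms sym CoDisk_CoDisk_meet[of c r] Half_CoDisk_meet[of _ _ c r] by (cases D) auto
    then obtain c' s where "D = Disk c' s" by blast
    with C assms show ?thesis
      using tangent_CoDisk_Disk[of r s c c'] by (simp del: aug_row.simps)
  next
    case C: (Half n d)
    show ?thesis
    proof (cases D)
      case (Disk c' s)
      with C assms show ?thesis
        using tangent_Half_Disk[of s n d c'] by (simp del: aug_row.simps)
    next
      case (CoDisk c' s)
      with C assms show ?thesis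
        using Half_CoDisk_meet[of n d c' s] by simp
    next
      case (Half n' d')
      with C assms show ?thesis
        using tangent_Half_Half[of n n' d d'] by (simp del: aug_row.simps)
    qed
  qed
qed

lemma is_oodc_gram:
  assumes "is_oodc X"
  shows "descartes_gram (augmatrix X)"
proof -
  have "lorentz (aug_row (snd X i)) (aug_row (snd X j)) = (if i = j then 1 else -1)" for i j
    using assms lorentz_tangent[of "snd X i" "snd X j"]
    by (auto simp: is_oodc_def lorentz_aug_row_self)
  then show ?thesis
    by (auto simp: descartes_gram_def augmatrix_def orient_sign_def)
qed

lemma augmatrix_curvature: "augmatrix X $ i $ 2 = curvature X i"
  by (cases "snd X i") (simp_all add: augmatrix_def curvature_def)

subsection \<open>The super-Apollonian group\<close>

lemma matrix_mult_row: "(U ** W) $ i = (\<Sum>k\<in>UNIV. U $ i $ k *\<^sub>R W $ k)"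
  for U W :: "real^4^4"
  by (simp add: vec_eq_iff matrix_matrix_mult_def)

text \<open>Writing the diagonal entry \<open>-1\<close> as \<open>2 - 3\<close> brings in the sum
  of all rows, the quantity followed in the descent.\<close>

lemma Smat_mult: "(Smat i ** W) $ j = (if j = i then 2 *\<^sub>R (\<Sum>k\<in>UNIV. W $ k) - 3 *\<^sub>R W $ i else W $ j)"
  for W :: "real^4^4"
proof (cases "j = i")
  case True
  have "(Smat i ** W) $ i = (\<Sum>k\<in>UNIV. 2 *\<^sub>R W $ k - (if k = i then 3 *\<^sub>R W $ k else 0))"
    unfolding matrix_mult_row by (rule sum.cong) (auto simp: Smat_def simp flip: scaleR_left_diff_distrib)
  with True show ?thesis by (simp add: sum_subtractf scaleR_sum_right)
next
  case False
  then have "(Smat i ** W) $ j = (\<Sum>k\<in>UNIV. if k = j then W $ k else 0)"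
    unfolding matrix_mult_row by (intro sum.cong) (auto simp: Smat_def)
  with False show ?thesis by simp
qed

lemma Sperp_mult: "(Sperp i ** W) $ j = (if j = i then - W $ i else W $ j + 2 *\<^sub>R W $ i)"
  for W :: "real^4^4"
proof -
  have "(Sperp i ** W) $ j = (\<Sum>k\<in>UNIV. (if k = j then (if j = i then 0 else W $ k) else 0) + (if k = i then (if j = i then -1 else 2) *\<^sub>R W $ k else 0))"
    unfolding matrix_mult_row by (intro sum.cong) (auto simp: Sperp_def transpose_def Smat_def)
  also have "\<dots> = (if j \<noteq> i then W $ j else 0) + (if j = i then -1 else 2) *\<^sub>R W $ i"
    unfolding sum.distrib by simp
  finally show ?thesis by auto
qed

lemma sum_Smat_mult: "(\<Sum>k\<in>UNIV. (Smat i ** W) $ k) = 3 *\<^sub>R (\<Sum>k\<in>UNIV. W $ k) - 4 *\<^sub>R W $ i"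
  for W :: "real^4^4"
  using exhaust_4[of i] by (auto simp: sum_4 Smat_mult vec_eq_iff)

lemma Smat_involution: "Smat i ** Smat i = mat 1"
proof -
  have "Smat i ** (Smat i ** W) = W" for W :: "real^4^4"
    unfolding vec_eq_iff[where 'b=4 and 'a="real^4"]
    by (simp add: Smat_mult[of i "Smat i ** W"] sum_Smat_mult) (auto simp: Smat_mult vec_eq_iff algebra_simps)
  from this[of "mat 1"] show ?thesis by simp
qed

lemma Sperp_involution: "Sperp i ** Sperp i = mat 1"
  by (metis Smat_involution Sperp_def matrix_transpose_mul transpose_mat)

lemma superApollonian_mult:
  assumes "U \<in> superApollonian" "V \<in> superApollonian"
  shows "U ** V \<in> superApollonian"
  using assms(1)
  by induction (auto simp: assms(2) simp flip: matrix_mul_assoc intro: superApollonian.intros)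

lemma superApollonian_generators: "Smat i \<in> superApollonian" "Sperp i \<in> superApollonian"
  using superApollonian.S[OF superApollonian.id] superApollonian.Sp[OF superApollonian.id] by simp_all

section \<open>Circles of an orbit and their invariance\<close>

definition packing_circles :: "real^4^4 \<Rightarrow> complex set set" where
  "packing_circles W = {gcircle (snd Y i) | Y i. is_oodc Y \<and> (\<exists>U\<in>superApollonian. augmatrix Y = U ** W)}"

lemma geometric_super_packing_eq: "geometric_super_packing X = packing_circles (augmatrix X)"
  by (auto simp: geometric_super_packing_def super_packing_def packing_circles_def)

text \<open>The common scheme of the invariance proofs: a map \<open>f\<close> on configurations
  carries one orbit into another and moves the circles by \<open>T\<close>, up to
  relabelling.\<close>

lemma packing_circles_mono_image:
  assumes "\<And>Y U. is_oodc Y \<Longrightarrow> U \<in> superApollonian \<Longrightarrow> augmatrix Y = U ** W \<Longrightarrow>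
     is_oodc (f Y) \<and> (\<exists>V\<in>superApollonian. augmatrix (f Y) = V ** W') \<and>
     (\<forall>i. \<exists>j. gcircle (snd (f Y) j) = T ` gcircle (snd Y i))"
  shows "(\<lambda>C. T ` C) ` packing_circles W \<subseteq> packing_circles W'"
proof
  fix C assume "C \<in> (\<lambda>C. T ` C) ` packing_circles W"
  then obtain Y i U where "C = T ` gcircle (snd Y i)" "is_oodc Y" "U \<in> superApollonian" "augmatrix Y = U ** W"
    by (auto simp: packing_circles_def)
  with assms[of Y U] obtain j where "C = gcircle (snd (f Y) j)" "is_oodc (f Y)"
    "\<exists>V\<in>superApollonian. augmatrix (f Y) = V ** W'" by metis
  then show "C \<in> packing_circles W'" unfolding packing_circles_def by blast
qed

lemma packing_circles_group_subset:
  assumes "V \<in> superApollonian"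
  shows "packing_circles (V ** W) \<subseteq> packing_circles W"
  using packing_circles_mono_image[of "V ** W" "\<lambda>Y. Y" W "\<lambda>z. z"] assms
  by (auto simp: matrix_mul_assoc intro: superApollonian_mult)

text \<open>A generator is an involution, so the inclusion for \<open>W\<close> and the one for
  \<open>Smat i ** W\<close> are converse to each other.\<close>

lemma packing_circles_Smat: "packing_circles (Smat i ** W) = packing_circles W"
  using packing_circles_group_subset[OF superApollonian_generators(1)[of i], of W]
    packing_circles_group_subset[OF superApollonian_generators(1)[of i], of "Smat i ** W"]
  by (simp add: matrix_mul_assoc Smat_involution)

lemma packing_circles_Sperp: "packing_circles (Sperp i ** W) = packing_circles W"
  using packing_circles_group_subset[OF superApollonian_generators(2)[of i], of W]
    packing_circles_group_subset[OF superApollonian_generators(2)[of i], of "Sperp i ** W"]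
  by (simp add: matrix_mul_assoc Sperp_involution)

text \<open>Reversing the orientation negates the coordinates but keeps the circles. This later
  allows a positive curvature sum to be assumed.\<close>

lemma packing_circles_uminus: "packing_circles (- W) = packing_circles W"
proof -
  define f :: "oodc \<Rightarrow> oodc" where "f = (\<lambda>Y. (\<not> fst Y, snd Y))"
  have f: "is_oodc (f Y) = is_oodc Y" "augmatrix (f Y) = - augmatrix Y" "snd (f Y) = snd Y" for Y
    by (auto simp: f_def is_oodc_def augmatrix_def orient_sign_def vec_eq_iff)
  have neg: "U ** (- V) = - (U ** V)" for U V :: "real^4^4"
    by (simp add: vec_eq_iff matrix_matrix_mult_def sum_negf)
  have "packing_circles V \<subseteq> packing_circles (- V)" for V
    using packing_circles_mono_image[of V f "- V" "\<lambda>z. z"] by (auto simp: f neg)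
  from this[of W] this[of "- W"] show ?thesis by auto
qed

text \<open>Conjugation by a permutation matrix permutes the generators: the one with index
  \<open>p k\<close> becomes the one with index \<open>k\<close>.\<close>

lemma superApollonian_permute:
  assumes "U \<in> superApollonian" "bij p"
  shows "(\<chi> i j. U $ p i $ p j) \<in> superApollonian"
  using assms(1)
proof induction
  case id
  have "(\<chi> i j. (mat 1 :: real^4^4) $ p i $ p j) = mat 1"
    using assms(2) by (auto simp: vec_eq_iff mat_def bij_def inj_def)
  then show ?case by (simp add: superApollonian.id)
next
  case (S U i)
  obtain k where k: "i = p k" using assms(2) by (metis bij_def surjD)
  have "(\<Sum>l\<in>UNIV. U $ p l $ c) = (\<Sum>l\<in>UNIV. U $ l $ c)" for c
    using assms(2) by (rule sum.reindex_bij_betw)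
  then have "(\<chi> l j. (Smat i ** U) $ p l $ p j) = Smat k ** (\<chi> l j. U $ p l $ p j)"
    using assms(2)
    by (auto simp: vec_eq_iff Smat_mult k bij_def inj_eq)
  with S show ?case by (simp add: superApollonian.S)
next
  case (Sp U i)
  obtain k where k: "i = p k" using assms(2) by (metis bij_def surjD)
  have "(\<chi> l j. (Sperp i ** U) $ p l $ p j) = Sperp k ** (\<chi> l j. U $ p l $ p j)"
    using assms(2) by (auto simp: vec_eq_iff Sperp_mult k bij_def inj_eq)
  with Sp show ?case by (simp add: superApollonian.Sp)
qed

lemma packing_circles_permute:
  assumes "bij p"
  shows "packing_circles (\<chi> i. W $ p i) = packing_circles W"
proof -
  \<comment> \<open>Stated for arbitrary \<open>V\<close> and \<open>p\<close> because it is used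
    both for the given permutation and for its inverse.\<close>
  have sub: "packing_circles V \<subseteq> packing_circles (\<chi> i. V $ p i)" if p: "bij p" for V and p :: "4 \<Rightarrow> 4"
  proof -
    define f :: "oodc \<Rightarrow> oodc" where "f = (\<lambda>Y. (fst Y, snd Y \<circ> p))"
    have "is_oodc (f Y)" if "is_oodc Y" for Y
      using that p by (simp add: f_def is_oodc_def bij_def inj_eq)
    moreover have "augmatrix (f Y) = (\<chi> i j. U $ p i $ p j) ** (\<chi> i. V $ p i)" if "augmatrix Y = U ** V" for Y U
    proof -
      have "augmatrix (f Y) $ i = (U ** V) $ p i" for i
        by (simp add: f_def augmatrix_def flip: that)
      moreover have "(U ** V) $ p i = ((\<chi> i j. U $ p i $ p j) ** (\<chi> i. V $ p i)) $ i" for i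
        using p sum.reindex_bij_betw[of p UNIV UNIV "\<lambda>k. U $ p i $ k *\<^sub>R V $ k"]
        by (simp add: matrix_mult_row)
      ultimately show ?thesis by (simp add: vec_eq_iff)
    qed
    moreover have "\<exists>j. gcircle (snd (f Y) j) = gcircle (snd Y i)" for Y i
      using p by (metis bij_def comp_apply f_def snd_conv surjD)
    ultimately show ?thesis
      using packing_circles_mono_image[of V f "\<chi> i. V $ p i" "\<lambda>z. z"] superApollonian_permute[OF _ p]
      by (simp, blast)
  qed
  have "bij (inv p)" using assms by (rule bij_imp_bij_inv)
  from sub[OF this, of "\<chi> i. W $ p i"] have "packing_circles (\<chi> i. W $ p i) \<subseteq> packing_circles W"
    using assms by (simp add: bij_def surj_f_inv_f)
  with sub[OF assms, of W] show ?thesis by blast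
qed

subsection \<open>Euclidean motions\<close>

text \<open>The action of \<open>f z + t\<close>, with \<open>f\<close> orthogonal, on oriented
  circles. The offset of a half-plane follows from
  \<open>f n \<bullet> (f z + t) = n \<bullet> z + f n \<bullet> t\<close>.\<close>

fun move :: "(complex \<Rightarrow> complex) \<Rightarrow> complex \<Rightarrow> gdisk \<Rightarrow> gdisk" where
  "move f t (Disk c r) = Disk (f c + t) r"
| "move f t (CoDisk c r) = CoDisk (f c + t) r"
| "move f t (Half n d) = Half (f n) (d + f n \<bullet> t)"

text \<open>Curvature times centre of the circle; for a line, its unit normal.\<close>

definition bc :: "real^4 \<Rightarrow> complex" where
  "bc u = Complex (u$3) (u$4)"

text \<open>The same motion in coordinates. For nonzero curvature \<open>b\<close> the first
  coordinate is \<open>((norm (bc u))\<^sup>2 - 1) / b\<close>; replacing \<open>bc u\<close> by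
  \<open>v + b *\<^sub>R t\<close> gives the formula, whose division-free form also covers
  lines.\<close>

definition aug_move :: "(complex \<Rightarrow> complex) \<Rightarrow> complex \<Rightarrow> real^4 \<Rightarrow> real^4" where
  "aug_move f t u =
    (let v = f (bc u) in
     vector [u$1 + 2 * (v \<bullet> t) + u$2 * (t \<bullet> t), u$2, Re (v + u$2 *\<^sub>R t), Im (v + u$2 *\<^sub>R t)])"

lemma aug_move_simps [simp]:
  "aug_move f t u $ 1 = u$1 + 2 * (f (bc u) \<bullet> t) + u$2 * (t \<bullet> t)"
  "aug_move f t u $ 2 = u$2"
  "bc (aug_move f t u) = f (bc u) + u$2 *\<^sub>R t"
  by (simp_all add: aug_move_def Let_def bc_def complex_eq_iff)

lemma bc_linear [simp]:
  "bc (u + v) = bc u + bc v" "bc (c *\<^sub>R u) = c *\<^sub>R bc u"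
  by (simp_all add: bc_def complex_eq_iff)

lemma vec4_eq_iff: "u = v \<longleftrightarrow> u$1 = v$1 \<and> u$2 = v$2 \<and> bc u = bc v" for u v :: "real^4"
  by (simp add: vec_eq_iff forall_4 bc_def)

text \<open>Being linear on rows, a motion commutes with left multiplication by the group, which
  only forms linear combinations of rows.\<close>

lemma linear_aug_move:
  assumes "linear f"
  shows "linear (aug_move f t)"
proof (rule linearI)
  fix u v :: "real^4" and c :: real
  show "aug_move f t (u + v) = aug_move f t u + aug_move f t v"
    using linear_add[OF assms] by (simp add: vec4_eq_iff inner_add_left algebra_simps)
  show "aug_move f t (c *\<^sub>R u) = c *\<^sub>R aug_move f t u"
    using linear_scale[OF assms] by (simp add: vec4_eq_iff algebra_simps)
qed

lemma lorentz_bc: "lorentz u v = bc u \<bullet> bc v - (u$1 * v$2 + u$2 * v$1) / 2"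
  by (simp add: lorentz_def inner_complex_def bc_def)

context
  fixes f :: "complex \<Rightarrow> complex" and t :: complex
  assumes f: "orthogonal_transformation f"
begin

lemma inner_move: "f z \<bullet> f w = z \<bullet> w"
  using f by (simp add: orthogonal_transformation_def)

lemma linear_move: "linear f"
  using f by (simp add: orthogonal_transformation_def)

lemma dist_move: "dist (f z) (f w) = dist z w"
  using f by (simp add: orthogonal_transformation_isometry)

lemma bij_move: "bij (\<lambda>z. f z + t)"
proof -
  have "bij ((\<lambda>z. z + t) \<circ> f)"
    by (intro bij_comp orthogonal_transformation_bij[OF f] bij_plus_right)
  then show ?thesis by (simp add: o_def)
qed

lemma move_wf: "gdisk_wf (move f t C) \<longleftrightarrow> gdisk_wf C"
  using orthogonal_transformation_norm[OF f] by (cases C) auto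

lemma image_move_eqI:
  assumes "\<And>z. f z + t \<in> A \<longleftrightarrow> z \<in> B"
  shows "A = (\<lambda>z. f z + t) ` B"
proof -
  have "(\<lambda>z. f z + t) -` A = B" using assms by auto
  then show ?thesis using bij_move by (metis bij_def surj_image_vimage_eq)
qed

lemma interior_move: "gdisk_interior (move f t C) = (\<lambda>z. f z + t) ` gdisk_interior C"
  by (rule image_move_eqI, cases C) (auto simp: dist_move inner_add_right inner_move)

lemma gcircle_move: "gcircle (move f t C) = (\<lambda>z. f z + t) ` gcircle C"
  by (rule image_move_eqI, cases C) (auto simp: dist_move inner_add_right inner_move)

lemma gcircle_hat_move: "gcircle_hat (move f t C) = map_option (\<lambda>z. f z + t) ` gcircle_hat C"
proof -
  \<comment> \<open>The point at infinity is split off: it lies exactly on the lines, and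
    \<open>map_option\<close> fixes it.\<close>
  have "gcircle_hat D = (if D \<in> range (case_prod Half) then {None} else {}) \<union> Some ` gcircle D" for D
    by (cases D) auto
  moreover have "move f t C \<in> range (case_prod Half) \<longleftrightarrow> C \<in> range (case_prod Half)"
    by (cases C) auto
  ultimately show ?thesis by (simp add: gcircle_move image_Un image_image)
qed

lemma tangent_move: "tangent (move f t C) (move f t D) \<longleftrightarrow> tangent C D"
proof -
  have inj: "inj (map_option (\<lambda>z. f z + t))"
    using bij_move by (simp add: bij_def option.inj_map)
  then show ?thesis
    by (simp add: tangent_def gcircle_hat_move card_image inj_on_subset flip: image_Int)
qed

lemma is_oodc_move: "is_oodc Y \<Longrightarrow> is_oodc (fst Y, move f t \<circ> snd Y)"
  using bij_move
  by (simp add: is_oodc_def move_wf tangent_move interior_move bij_def flip: image_Int)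

lemma aug_row_move: "gdisk_wf C \<Longrightarrow> aug_row (move f t C) = aug_move f t (aug_row C)"
proof (cases C)
  case (Disk c r)
  assume "gdisk_wf C"
  with Disk have r: "r > 0" by simp
  have b: "bc (aug_row (Disk a r)) = (1/r) *\<^sub>R a" for a by (simp add: bc_def complex_eq_iff)
  have "(cmod (f c + t))\<^sup>2 = (cmod c)\<^sup>2 + 2 * (f c \<bullet> t) + t \<bullet> t"
    unfolding power2_norm_eq_inner by (simp add: inner_add_left inner_add_right inner_move inner_commute)
  then show ?thesis unfolding Disk
    using r unfolding vec4_eq_iff aug_move_simps move.simps b linear_scale[OF linear_move]
    by (simp add: field_simps scaleR_add_right)
next
  case (CoDisk c r)
  assume "gdisk_wf C"
  with CoDisk have r: "r > 0" by simp
  have b: "bc (aug_row (CoDisk a r)) = (-1/r) *\<^sub>R a" for a by (simp add: bc_def complex_eq_iff)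
  have "(cmod (f c + t))\<^sup>2 = (cmod c)\<^sup>2 + 2 * (f c \<bullet> t) + t \<bullet> t"
    unfolding power2_norm_eq_inner by (simp add: inner_add_left inner_add_right inner_move inner_commute)
  then show ?thesis unfolding CoDisk
    using r unfolding vec4_eq_iff aug_move_simps move.simps b linear_scale[OF linear_move]
    by (simp add: field_simps scaleR_add_right)
next
  case (Half n d)
  have b: "bc (aug_row (Half n d)) = n" for n d by (simp add: bc_def)
  show ?thesis unfolding Half
    unfolding vec4_eq_iff aug_move_simps move.simps b by simp
qed

lemma augmatrix_move:
  fixes U W :: "real^4^4"
  assumes "is_oodc Y" "augmatrix Y = U ** W"
  shows "augmatrix (fst Y, move f t \<circ> snd Y) = U ** (\<chi> i. aug_move f t (W $ i))"
proof -
  note lin = linear_aug_move[OF linear_move, of t]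
  have "augmatrix (fst Y, move f t \<circ> snd Y) $ i = aug_move f t (augmatrix Y $ i)" for i
    using assms(1) by (simp add: augmatrix_def aug_row_move is_oodc_def linear_scale[OF lin])
  also have "\<dots> i = (U ** (\<chi> i. aug_move f t (W $ i))) $ i" for i
    by (simp add: assms(2) matrix_mult_row linear_sum[OF lin] linear_scale[OF lin])
  finally show ?thesis by (simp add: vec_eq_iff)
qed

lemma packing_circles_move_subset:
  "(\<lambda>C. (\<lambda>z. f z + t) ` C) ` packing_circles W \<subseteq> packing_circles (\<chi> i. aug_move f t (W $ i))"
  by (rule packing_circles_mono_image[where f = "\<lambda>Y. (fst Y, move f t \<circ> snd Y)"])
    (auto simp: is_oodc_move gcircle_move augmatrix_move)

end

lemma packing_circles_move:
  assumes f: "orthogonal_transformation f"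
  shows "packing_circles (\<chi> i. aug_move f t (W $ i)) = (\<lambda>C. (\<lambda>z. f z + t) ` C) ` packing_circles W"
    (is "packing_circles ?W = ?T ` _")
proof
  show "?T ` packing_circles W \<subseteq> packing_circles ?W"
    by (rule packing_circles_move_subset[OF f])
  define g where "g = inv f"
  \<comment> \<open>The inverse of \<open>f z + t\<close> is \<open>g z - g t\<close>, again a
    motion of the same form, so the inclusion already proved also yields its converse.\<close>
  define s where "s = - g t"
  have g: "orthogonal_transformation g" unfolding g_def by (rule orthogonal_transformation_inv[OF f])
  have fg: "f (g z) = z" "g (f z) = z" for z
    using orthogonal_transformation_bij[OF f] by (simp_all add: g_def bij_def surj_f_inv_f)
  have lin: "linear f" "linear g" using f g by (simp_all add: orthogonal_transformation_def)
  have inv: "aug_move g s (aug_move f t u) = u" for u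
  proof -
    have 1: "g t \<bullet> g t = t \<bullet> t" using inner_move[OF g] .
    have 2: "bc u \<bullet> g t = f (bc u) \<bullet> t" using inner_move[OF f, of "bc u" "g t"] by (simp add: fg)
    show ?thesis
      by (simp add: vec4_eq_iff linear_add[OF lin(2)] linear_scale[OF lin(2)] fg s_def inner_add_left 1 2)
  qed
  have T: "f (g z + s) + t = z" for z
    by (simp add: s_def linear_diff[OF lin(1)] fg)
  have "(\<lambda>C. (\<lambda>z. g z + s) ` C) ` packing_circles ?W \<subseteq> packing_circles W"
    using packing_circles_move_subset[OF g, of s ?W] by (simp add: inv)
  then have "?T ` ((\<lambda>C. (\<lambda>z. g z + s) ` C) ` packing_circles ?W) \<subseteq> ?T ` packing_circles W"
    by (rule image_mono)
  then show "packing_circles ?W \<subseteq> ?T ` packing_circles W"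
    by (simp add: image_image T)
qed

subsection \<open>Reduction of integral configurations\<close>

text \<open>\<open>Sperp i\<close> is the Lorentz reflection in row \<open>i\<close>, that is,
  inversion in the \<open>i\<close>-th circle with that circle reversed. \<open>Smat i\<close> swaps
  row \<open>i\<close> for the other solution of the same Gram relations with the remaining three
  rows.\<close>

lemma descartes_gram_generators:
  assumes "descartes_gram W"
  shows "descartes_gram (Smat i ** W)" "descartes_gram (Sperp i ** W)"
proof -
  have lin: "lorentz (u + u') v = lorentz u v + lorentz u' v" "lorentz v (u + u') = lorentz v u + lorentz v u'"
    "lorentz (u - u') v = lorentz u v - lorentz u' v" "lorentz v (u - u') = lorentz v u - lorentz v u'"
    "lorentz (c *\<^sub>R u) v = c * lorentz u v" "lorentz v (c *\<^sub>R u) = c * lorentz v u"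
    "lorentz (- u) v = - lorentz u v" "lorentz v (- u) = - lorentz v u"
    for u u' v c
    by (simp_all add: lorentz_def field_simps)
  show "descartes_gram (Smat i ** W)" "descartes_gram (Sperp i ** W)"
    using assms exhaust_4[of i] unfolding descartes_gram_def forall_4
    by (auto simp: Smat_mult Sperp_mult sum_4 lin)
qed

text \<open>The Gram matrix \<open>2 I - J\<close> is four times its own inverse, so the rows of \<open>W\<close> being
  dual to each other turns into the dual relation between the columns of \<open>W\<close>.\<close>
lemma descartes_relation:
  assumes "descartes_gram W"
  shows "2 * (\<Sum>i\<in>UNIV. (W $ i $ 2)\<^sup>2) = (\<Sum>i\<in>UNIV. W $ i $ 2)\<^sup>2"
proof -
  define B :: "real^4^4" where "B = vector [vector [0, -1/2, 0, 0], vector [-1/2, 0, 0, 0],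
    vector [0, 0, 1, 0], vector [0, 0, 0, 1]]"
  define G :: "real^4^4" where "G = (\<chi> i j. if i = j then 1/4 else -1/4)"
  have B: "W ** (B ** transpose W) = (\<chi> i j. lorentz (W$i) (W$j))"
    by (simp add: vec_eq_iff matrix_matrix_mult_def sum_4 transpose_def B_def lorentz_def field_simps)
  have "(\<chi> i j. lorentz (W$i) (W$j)) = (\<chi> i j. if i = j then 1 else -1)"
    using assms by (simp add: descartes_gram_def)
  then have "W ** (B ** transpose W) ** G = (\<chi> i j. if i = j then 1 else -1) ** G"
    unfolding B by simp
  also have "\<dots> = mat 1"
    by (simp add: vec_eq_iff forall_4 matrix_matrix_mult_def sum_4 G_def mat_def)
  finally have "(B ** transpose W) ** G ** W = mat 1"
    by (metis matrix_left_right_inverse matrix_mul_assoc)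
  \<comment> \<open>The first row of \<open>B ** transpose W\<close> is \<open>-1/2\<close> times
    the curvature column, so this entry is \<open>-1/2\<close> times the quadratic form of
    \<open>G\<close> at the curvatures.\<close>
  then have "((B ** transpose W) ** G ** W) $ 1 $ 2 = 0"
    by (simp add: mat_def)
  then show ?thesis
    by (simp add: matrix_matrix_mult_def sum_4 transpose_def B_def G_def power2_eq_square field_simps)
qed

text \<open>Cauchy-Schwarz for the other three numbers turns the relation into a quadratic
  inequality in \<open>a\<close>. The two bounds keep the new sums \<open>3 * s - 4 * a\<close> and
  \<open>s + 4 * a\<close> of the descent positive.\<close>

lemma descartes_relation_bounds:
  fixes a x y z :: real
  assumes "2 * (a\<^sup>2 + x\<^sup>2 + y\<^sup>2 + z\<^sup>2) = (a + x + y + z)\<^sup>2" and "a + x + y + z > 0"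
  shows "4 * a < 3 * (a + x + y + z)" "0 < (a + x + y + z) + 4 * a"
proof -
  define s where "s = a + x + y + z"
  have s: "s > 0" using assms(2) by (simp add: s_def)
  have "0 \<le> (x - y)\<^sup>2 + (y - z)\<^sup>2 + (z - x)\<^sup>2" by simp
  also have "\<dots> = 3 * (x\<^sup>2 + y\<^sup>2 + z\<^sup>2) - (x + y + z)\<^sup>2" by (simp add: power2_eq_square algebra_simps)
  also have "x + y + z = s - a" by (simp add: s_def)
  also have "x\<^sup>2 + y\<^sup>2 + z\<^sup>2 = s\<^sup>2 / 2 - a\<^sup>2" using assms(1) by (simp add: s_def)
  finally have "8 * a\<^sup>2 - 4 * s * a - s\<^sup>2 \<le> 0" by (simp add: power2_eq_square algebra_simps)
  moreover have "(4 * a - 3 * s) * (4 * a + s) = 2 * (8 * a\<^sup>2 - 4 * s * a - s\<^sup>2) - s\<^sup>2"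
    by (simp add: power2_eq_square algebra_simps)
  moreover have "s\<^sup>2 > 0" using s by simp
  ultimately have "(4 * a - 3 * s) * (4 * a + s) < 0" by argo
  \<comment> \<open>The factors differ by \<open>4 * s > 0\<close>, so the smaller one is negative
    and the larger one positive.\<close>
  then have "4 * a - 3 * s < 0 \<and> 0 < 4 * a + s" using s by (auto simp: mult_less_0_iff)
  then show "4 * a < 3 * (a + x + y + z)" "0 < (a + x + y + z) + 4 * a"
    unfolding s_def[symmetric] by simp_all
qed

lemma descartes_gram_bounds:
  assumes "descartes_gram W" "(\<Sum>k\<in>UNIV. W $ k $ 2) > 0"
  shows "4 * W $ i $ 2 < 3 * (\<Sum>k\<in>UNIV. W $ k $ 2)" "0 < (\<Sum>k\<in>UNIV. W $ k $ 2) + 4 * W $ i $ 2"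
proof -
  let ?b = "\<lambda>k. W $ k $ 2"
  have "\<exists>x y z. sum ?b UNIV = ?b i + x + y + z \<and> (\<Sum>k\<in>UNIV. (?b k)\<^sup>2) = (?b i)\<^sup>2 + x\<^sup>2 + y\<^sup>2 + z\<^sup>2"
    using exhaust_4[of i]
  proof (elim disjE)
    assume "i = 1" then show ?thesis by (intro exI[of _ "?b 2"] exI[of _ "?b 3"] exI[of _ "?b 4"]) (simp add: sum_4)
  next
    assume "i = 2" then show ?thesis by (intro exI[of _ "?b 1"] exI[of _ "?b 3"] exI[of _ "?b 4"]) (simp add: sum_4)
  next
    assume "i = 3" then show ?thesis by (intro exI[of _ "?b 1"] exI[of _ "?b 2"] exI[of _ "?b 4"]) (simp add: sum_4)
  next
    assume "i = 4" then show ?thesis by (intro exI[of _ "?b 1"] exI[of _ "?b 2"] exI[of _ "?b 3"]) (simp add: sum_4)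
  qed
  then obtain x y z where "sum ?b UNIV = ?b i + x + y + z" "(\<Sum>k\<in>UNIV. (?b k)\<^sup>2) = (?b i)\<^sup>2 + x\<^sup>2 + y\<^sup>2 + z\<^sup>2"
    by blast
  then show "4 * ?b i < 3 * sum ?b UNIV" "0 < sum ?b UNIV + 4 * ?b i"
    using descartes_relation_bounds[of "?b i" x y z] descartes_relation[OF assms(1)] assms(2) by simp_all
qed

text \<open>\<open>Smat i\<close> lowers the curvature sum if \<open>b i\<close> exceeds half of it, and \<open>Sperp i\<close> does if
  \<open>b i < 0\<close>. If neither applies then \<open>0 \<le> b i \<le> s / 2\<close> for all \<open>i\<close>, and
  \<open>2 * (\<Sum> b i ^ 2) = s ^ 2\<close> is the equality case of \<open>b i ^ 2 \<le> b i * (s / 2)\<close>.\<close>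
lemma descartes_reduction:
  fixes c :: "4 \<Rightarrow> int"
  assumes "descartes_gram W" "\<And>i. W $ i $ 2 = of_int (c i)" "sum c UNIV > 0"
    "\<And>d. (\<forall>i. d dvd c i) \<longleftrightarrow> d dvd g"
  shows "\<exists>V b. packing_circles V = packing_circles W \<and> descartes_gram V \<and> (\<forall>i. V $ i $ 2 = of_int (b i)) \<and>
    (\<forall>i. 2 * b i \<in> {0, sum b UNIV}) \<and> sum b UNIV > 0 \<and> (\<forall>d. (\<forall>i. d dvd b i) \<longleftrightarrow> d dvd g)"
  using assms
proof (induction "nat (sum c UNIV)" arbitrary: W c rule: less_induct)
  case less
  have sumW: "(\<Sum>k\<in>UNIV. W $ k $ 2) = of_int (sum c UNIV)" using less.prems(2) by simp
  then have pos: "(\<Sum>k\<in>UNIV. W $ k $ 2) > 0" using less.prems(3) by linarith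
  have bounds: "4 * c i < 3 * sum c UNIV" "0 < sum c UNIV + 4 * c i" for i
    using descartes_gram_bounds[OF less.prems(1) pos, of i] unfolding sumW unfolding less.prems(2)
    by linarith+
  consider i where "2 * c i > sum c UNIV" | i where "c i < 0"
    | "\<forall>i. 0 \<le> c i \<and> 2 * c i \<le> sum c UNIV" by (meson not_le)
  then show ?case
  proof cases
    case (1 i)
    define c' where "c' = (\<lambda>j. if j = i then 2 * sum c UNIV - 3 * c i else c j)"
    have "sum c' UNIV = 3 * sum c UNIV - 4 * c i"
      using exhaust_4[of i] by (auto simp: c'_def sum_4)
    then have lt: "nat (sum c' UNIV) < nat (sum c UNIV)" and p: "sum c' UNIV > 0"
      using 1 bounds[of i] by auto
    \<comment> \<open>Old and new entry add up to twice the sum of the other three, so a common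
      divisor of those divides both entries or neither.\<close>
    have "sum c UNIV - c i = sum c (UNIV - {i})" by (simp add: sum_diff1)
    then have e: "c' i + c i = 2 * sum c (UNIV - {i})" by (simp add: c'_def)
    have d: "(\<forall>j. d dvd c' j) \<longleftrightarrow> d dvd g" for d
    proof -
      have "(d dvd c' i) \<longleftrightarrow> (d dvd c i)" if "\<forall>j. j \<noteq> i \<longrightarrow> d dvd c j"
      proof -
        have "d dvd c' i + c i" unfolding e by (intro dvd_mult dvd_sum) (use that in auto)
        then show ?thesis by (metis dvd_add_left_iff dvd_add_right_iff)
      qed
      moreover have "c' j = c j" if "j \<noteq> i" for j using that by (simp add: c'_def)
      ultimately have "(\<forall>j. d dvd c' j) \<longleftrightarrow> (\<forall>j. d dvd c j)" by metis
      then show ?thesis using less.prems(4) by blast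
    qed
    have W': "(Smat i ** W) $ j $ 2 = of_int (c' j)" for j
      by (auto simp: Smat_mult c'_def less.prems(2))
    show ?thesis
      using less.hyps[OF lt descartes_gram_generators(1)[OF less.prems(1)] W' p d]
      unfolding packing_circles_Smat .
  next
    case (2 i)
    define c' where "c' = (\<lambda>j. if j = i then - c i else c j + 2 * c i)"
    have "sum c' UNIV = sum c UNIV + 4 * c i"
      using exhaust_4[of i] by (auto simp: c'_def sum_4)
    then have lt: "nat (sum c' UNIV) < nat (sum c UNIV)" and p: "sum c' UNIV > 0"
      using 2 bounds[of i] by auto
    have d: "(\<forall>j. d dvd c' j) \<longleftrightarrow> d dvd g" for d
    proof -
      have "(d dvd c j + 2 * c i) \<longleftrightarrow> d dvd c j" if "d dvd c i" for j
        using that by (simp add: dvd_add_left_iff)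
      then have "(\<forall>j. d dvd c' j) \<longleftrightarrow> (\<forall>j. d dvd c j)" unfolding c'_def by (metis dvd_minus_iff)
      then show ?thesis using less.prems(4) by blast
    qed
    have W': "(Sperp i ** W) $ j $ 2 = of_int (c' j)" for j
      by (auto simp: Sperp_mult c'_def less.prems(2))
    show ?thesis
      using less.hyps[OF lt descartes_gram_generators(2)[OF less.prems(1)] W' p d]
      unfolding packing_circles_Sperp .
  next
    case 3
    have rel: "2 * (\<Sum>i\<in>UNIV. (c i)\<^sup>2) = (sum c UNIV)\<^sup>2"
    proof -
      have "real_of_int (2 * (\<Sum>i\<in>UNIV. (c i)\<^sup>2)) = real_of_int ((sum c UNIV)\<^sup>2)"
        using descartes_relation[OF less.prems(1)] unfolding sumW unfolding less.prems(2) by simp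
      then show ?thesis by (simp only: of_int_eq_iff)
    qed
    have "(\<Sum>i\<in>UNIV. c i * (sum c UNIV - 2 * c i)) = (sum c UNIV)\<^sup>2 - 2 * (\<Sum>i\<in>UNIV. (c i)\<^sup>2)"
      by (simp add: sum_4 power2_eq_square algebra_simps)
    then have "(\<Sum>i\<in>UNIV. c i * (sum c UNIV - 2 * c i)) = 0" using rel by simp
    then have "c i * (sum c UNIV - 2 * c i) = 0" for i
      using 3 by (subst (asm) sum_nonneg_eq_0_iff) auto
    then have "2 * c i \<in> {0, sum c UNIV}" for i by force
    then show ?thesis using less.prems by blast
  qed
qed

subsection \<open>The normal form\<close>

text \<open>Curvatures \<open>(0, 0, h, h)\<close>: two parallel lines and two touching circles between them.\<close>

definition two_lines_conf :: "real \<Rightarrow> oodc" where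
  "two_lines_conf h = (True, \<lambda>i. if i = 1 then Half \<i> (1/h) else if i = 2 then Half (-\<i>) (1/h)
     else if i = 3 then Disk 0 (1/h) else Disk (complex_of_real (2/h)) (1/h))"

lemma tangentI: "gcircle_hat C \<inter> gcircle_hat D = {p} \<Longrightarrow> tangent C D"
  by (simp add: tangent_def)

text \<open>The sign \<open>s\<close> handles the upper and the lower line at once. Their only
  common point with the circle is the one straight above or below its centre.\<close>

lemma line_touches_circle:
  assumes "r > 0" "s\<^sup>2 = 1"
  shows "gdisk_interior (Half (Complex 0 s) r) \<inter> gdisk_interior (Disk (complex_of_real x) r) = {}"
    "tangent (Half (Complex 0 s) r) (Disk (complex_of_real x) r)"
proof -
  have s: "s * s = 1" using assms(2) by (simp add: power2_eq_square)
  have s': "(s * y)\<^sup>2 = y\<^sup>2" for y using assms(2) by (simp add: power_mult_distrib)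
  have d: "(dist (complex_of_real x) z)\<^sup>2 = (Re z - x)\<^sup>2 + (Im z)\<^sup>2" for z
    unfolding dist_norm cmod_power2 by (simp add: power2_commute)
  show "gdisk_interior (Half (Complex 0 s) r) \<inter> gdisk_interior (Disk (complex_of_real x) r) = {}"
  proof -
    have False if "r < s * Im z" "dist (complex_of_real x) z < r" for z
    proof -
      have "(dist (complex_of_real x) z)\<^sup>2 < r\<^sup>2" using that by (simp add: power_strict_mono)
      moreover have "r\<^sup>2 < (s * Im z)\<^sup>2" using that assms by (simp add: power_strict_mono)
      moreover have "0 \<le> (Re z - x)\<^sup>2" by simp
      ultimately show False unfolding d s' by linarith
    qed
    then show ?thesis by (auto simp: inner_complex_def)
  qed
  have "z = Complex x (s * r)" if "s * Im z = r" "dist (complex_of_real x) z = r" for z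
  proof -
    have "(Re z - x)\<^sup>2 + (Im z)\<^sup>2 = (s * Im z)\<^sup>2" using d[of z] that by simp
    then have "Re z = x" by (simp add: s')
    moreover have "s * r = (s * s) * Im z" using that by simp
    ultimately show ?thesis using s by (simp add: complex_eq_iff)
  qed
  moreover have "dist (complex_of_real x) (Complex x (s * r)) = r"
  proof -
    have "(dist (complex_of_real x) (Complex x (s * r)))\<^sup>2 = r\<^sup>2" unfolding d by (simp add: s')
    then show ?thesis using assms(1) by (simp add: power2_eq_iff_nonneg)
  qed
  moreover have "s * (s * r) = r" using s by (simp flip: mult.assoc)
  ultimately have "{z. s * Im z = r} \<inter> sphere (complex_of_real x) r = {Complex x (s * r)}"
    by auto
  then have "gcircle_hat (Half (Complex 0 s) r) \<inter> gcircle_hat (Disk (complex_of_real x) r) = {Some (Complex x (s * r))}"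
    by (auto simp: inner_complex_def)
  then show "tangent (Half (Complex 0 s) r) (Disk (complex_of_real x) r)" by (rule tangentI)
qed

lemma circle_touches_circle:
  assumes "r > 0"
  shows "ball 0 r \<inter> ball (complex_of_real (2 * r)) r = {}"
    "tangent (Disk 0 r) (Disk (complex_of_real (2 * r)) r)"
proof -
  show "ball 0 r \<inter> ball (complex_of_real (2 * r)) r = {}"
    using assms by (intro disjoint_ballI) (simp add: norm_mult)
  have "z = complex_of_real r" if "norm z = r" "dist (complex_of_real (2 * r)) z = r" for z
  proof -
    have 1: "(Re z)\<^sup>2 + (Im z)\<^sup>2 = r\<^sup>2" using that(1) by (simp flip: cmod_power2)
    have "(dist (complex_of_real (2 * r)) z)\<^sup>2 = r\<^sup>2" using that by simp
    then have 2: "(2 * r - Re z)\<^sup>2 + (Im z)\<^sup>2 = r\<^sup>2" unfolding dist_norm cmod_power2 by simp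
    \<comment> \<open>Subtracting the two circle equations leaves a linear equation for
      \<open>Re z\<close>.\<close>
    have "(2 * r - Re z)\<^sup>2 - (Re z)\<^sup>2 = 4 * r * (r - Re z)"
      by (simp add: power2_eq_square algebra_simps)
    then have "4 * r * (r - Re z) = 0" using 1 2 by linarith
    then have "Re z = r" using assms by auto
    with 1 show ?thesis by (simp add: complex_eq_iff)
  qed
  moreover have "dist (complex_of_real (2 * r)) (complex_of_real r) = r"
    using assms by (simp add: dist_norm flip: of_real_diff)
  ultimately have "sphere 0 r \<inter> sphere (complex_of_real (2 * r)) r = {complex_of_real r}"
    using assms by auto
  then have "gcircle_hat (Disk 0 r) \<inter> gcircle_hat (Disk (complex_of_real (2 * r)) r) = {Some (complex_of_real r)}"
    by auto
  then show "tangent (Disk 0 r) (Disk (complex_of_real (2 * r)) r)" by (rule tangentI)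
qed

lemma is_oodc_two_lines_conf:
  assumes "h > 0"
  shows "is_oodc (two_lines_conf h)"
proof -
  define r where "r = 1 / h"
  have r: "r > 0" using assms by (simp add: r_def)
  let ?P = "\<lambda>C D. gdisk_interior C \<inter> gdisk_interior D = {} \<and> tangent C D"
  have sym: "?P C D \<longleftrightarrow> ?P D C" for C D by (auto simp: tangent_sym)
  have i: "\<i> = Complex 0 1" "- \<i> = Complex 0 (-1)" by (simp_all add: complex_eq_iff)
  have "?P (Half \<i> r) (Half (-\<i>) r)"
  proof
    show "gdisk_interior (Half \<i> r) \<inter> gdisk_interior (Half (-\<i>) r) = {}"
      using r by (auto simp: inner_complex_def)
    have "gcircle_hat (Half \<i> r) \<inter> gcircle_hat (Half (-\<i>) r) = {None}"
      using r by (auto simp: inner_complex_def)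
    then show "tangent (Half \<i> r) (Half (-\<i>) r)" by (rule tangentI)
  qed
  moreover have "?P (Half \<i> r) (Disk (complex_of_real x) r)" "?P (Half (-\<i>) r) (Disk (complex_of_real x) r)" for x
    unfolding i(2) unfolding i(1)
    using line_touches_circle[OF r, of 1 x] line_touches_circle[OF r, of "-1" x] by simp_all
  note this[of 0, unfolded of_real_0] this[of "2 * r"]
  moreover have "?P (Disk 0 r) (Disk (complex_of_real (2 * r)) r)"
    using circle_touches_circle[OF r] by simp
  ultimately have P: "?P (snd (two_lines_conf h) 1) (snd (two_lines_conf h) 2)"
    "?P (snd (two_lines_conf h) 1) (snd (two_lines_conf h) 3)"
    "?P (snd (two_lines_conf h) 1) (snd (two_lines_conf h) 4)"
    "?P (snd (two_lines_conf h) 2) (snd (two_lines_conf h) 3)"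
    "?P (snd (two_lines_conf h) 2) (snd (two_lines_conf h) 4)"
    "?P (snd (two_lines_conf h) 3) (snd (two_lines_conf h) 4)"
    by (simp_all add: two_lines_conf_def r_def)
  have "?P (snd (two_lines_conf h) i) (snd (two_lines_conf h) j)" if "i \<noteq> j" for i j
    using exhaust_4[of i] exhaust_4[of j] that P P[THEN sym[THEN iffD1]] by (elim disjE) (simp only:)+
  moreover have "gdisk_wf (snd (two_lines_conf h) i)" for i
    using assms by (simp add: two_lines_conf_def)
  ultimately show ?thesis unfolding is_oodc_def by blast
qed

lemma augmatrix_two_lines_conf:
  assumes "h > 0"
  defines "W \<equiv> augmatrix (two_lines_conf h)"
  shows "W $ 1 $ 1 = 2 / h" "W $ 1 $ 2 = 0" "bc (W $ 1) = \<i>"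
    "W $ 2 $ 1 = 2 / h" "W $ 2 $ 2 = 0" "bc (W $ 2) = -\<i>"
    "W $ 3 $ 1 = - 1 / h" "W $ 3 $ 2 = h" "bc (W $ 3) = 0"
    "W $ 4 $ 1 = 3 / h" "W $ 4 $ 2 = h" "bc (W $ 4) = 2"
proof -
  have c: "cmod (2 / complex_of_real h) = 2 / h" using assms(1) by (simp add: norm_divide)
  have "((cmod (2 / complex_of_real h))\<^sup>2 - (1 / h)\<^sup>2) * h = 3 / h"
    unfolding c using assms(1) by (simp add: power2_eq_square field_simps)
  then show "W $ 1 $ 1 = 2 / h" "W $ 1 $ 2 = 0" "bc (W $ 1) = \<i>"
    "W $ 2 $ 1 = 2 / h" "W $ 2 $ 2 = 0" "bc (W $ 2) = -\<i>"
    "W $ 3 $ 1 = - 1 / h" "W $ 3 $ 2 = h" "bc (W $ 3) = 0"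
    "W $ 4 $ 1 = 3 / h" "W $ 4 $ 2 = h" "bc (W $ 4) = 2"
    using assms(1)
    by (simp_all add: W_def augmatrix_def two_lines_conf_def orient_sign_def bc_def complex_eq_iff
        power2_eq_square)
qed

text \<open>The Gram relations provide an orthonormal frame, namely the line normal and the
  direction between the two centres. This frame gives \<open>f\<close>, and the centre of the third
  circle gives \<open>t\<close>.\<close>

lemma two_lines_normal_form:
  assumes "descartes_gram V" "h > 0"
    and b: "V $ 1 $ 2 = 0" "V $ 2 $ 2 = 0" "V $ 3 $ 2 = h" "V $ 4 $ 2 = h"
  obtains f t where "orthogonal_transformation f" "V = (\<chi> i. aug_move f t (augmatrix (two_lines_conf h) $ i))"
proof -
  define v where "v i = bc (V $ i)" for i
  define p where "p i = V $ i $ 1" for i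
  have G: "v i \<bullet> v j - (p i * V $ j $ 2 + V $ i $ 2 * p j) / 2 = (if i = j then 1 else -1)" for i j
    using assms(1) by (simp add: descartes_gram_def lorentz_bc v_def p_def)
  have g: "v 1 \<bullet> v 1 = 1" "v 2 \<bullet> v 2 = 1" "v 1 \<bullet> v 2 = -1"
    "v 1 \<bullet> v 3 = p 1 * h / 2 - 1" "v 2 \<bullet> v 3 = p 2 * h / 2 - 1" "v 1 \<bullet> v 4 = p 1 * h / 2 - 1"
    "v 3 \<bullet> v 3 = 1 + p 3 * h" "v 4 \<bullet> v 4 = 1 + p 4 * h" "v 3 \<bullet> v 4 = (p 3 + p 4) * h / 2 - 1"
    using G[of 1 1] G[of 2 2] G[of 1 2] G[of 1 3] G[of 2 3] G[of 1 4] G[of 3 3] G[of 4 4] G[of 3 4]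
    by (simp_all add: b algebra_simps)
  have "(v 1 + v 2) \<bullet> (v 1 + v 2) = 0"
    using g by (simp add: inner_add_left inner_add_right inner_commute)
  then have v2: "v 2 = - v 1" by (metis add_eq_0_iff inner_eq_zero_iff)
  \<comment> \<open>The centres are \<open>2 / h\<close> apart, so half of the difference of the
    curvature-weighted centres is a unit vector. \<open>f\<close> sends \<open>1\<close> to
    \<open>m\<close> and \<open>\<i>\<close> to \<open>v 1\<close>; it may reverse the orientation
    of the plane.\<close>
  define m where "m = (1/2) *\<^sub>R (v 4 - v 3)"
  define t where "t = (1/h) *\<^sub>R v 3"
  define f where "f z = Re z *\<^sub>R m + Im z *\<^sub>R v 1" for z
  have mm: "m \<bullet> m = 1" "m \<bullet> v 1 = 0" "v 1 \<bullet> m = 0"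
    using g by (simp_all add: m_def inner_diff_left inner_diff_right inner_commute algebra_simps)
  have "linear f"
    by (rule linearI) (simp_all add: f_def algebra_simps)
  moreover have "f z \<bullet> f w = z \<bullet> w" for z w
    using mm g(1) by (simp add: f_def inner_add_left inner_add_right complex_inner_eq[of z w])
  ultimately have f: "orthogonal_transformation f" by (simp add: orthogonal_transformation_def)
  let ?W = "augmatrix (two_lines_conf h)"
  note W = augmatrix_two_lines_conf[OF assms(2)]
  have F: "f \<i> = v 1" "f (-\<i>) = - v 1" "f 0 = 0" "f 2 = v 4 - v 3"
    by (simp_all add: f_def m_def)
  have ht: "h *\<^sub>R t = v 3" using assms(2) by (simp add: t_def)
  have it: "w \<bullet> t = (w \<bullet> v 3) / h" for w by (simp add: t_def)
  have tt: "h * (t \<bullet> t) = (v 3 \<bullet> v 3) / h" using assms(2) by (simp add: t_def)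
  \<comment> \<open>Each first coordinate is recovered from the Lorentz product of its row with the
    third row.\<close>
  have "p 1 = 2 / h + 2 * (v 1 \<bullet> t)" "p 2 = 2 / h + 2 * (- v 1 \<bullet> t)" "p 3 = - 1 / h + h * (t \<bullet> t)"
    "p 4 = 3 / h + 2 * ((v 4 - v 3) \<bullet> t) + h * (t \<bullet> t)"
    using assms(2) g(5) unfolding tt unfolding it v2 inner_diff_left inner_commute[of "v 4"] g(4,7,9) inner_minus_left
    by (simp_all add: field_simps)
  then have "V $ 1 = aug_move f t (?W $ 1)" "V $ 2 = aug_move f t (?W $ 2)"
      "V $ 3 = aug_move f t (?W $ 3)" "V $ 4 = aug_move f t (?W $ 4)"
    unfolding vec4_eq_iff aug_move_simps W F b v_def[symmetric] p_def[symmetric] ht v2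
    by simp_all
  then have "V = (\<chi> i. aug_move f t (?W $ i))"
    by (subst vec_eq_iff) (simp add: forall_4)
  with f show ?thesis by (rule that)
qed

section \<open>From integral curvatures to the normal form\<close>

lemma bij_four_points:
  fixes a b c d :: 4
  assumes "distinct [a, b, c, d]"
  obtains p :: "4 \<Rightarrow> 4" where "bij p" "p 1 = a" "p 2 = b" "p 3 = c" "p 4 = d"
proof -
  define p :: "4 \<Rightarrow> 4" where "p x = (if x = 1 then a else if x = 2 then b else if x = 3 then c else d)" for x
  have "inj p"
    using assms unfolding inj_def forall_4 by (auto simp: p_def)
  then have "bij p" by (simp add: bij_def finite_UNIV_inj_surj)
  then show ?thesis by (rule that) (simp_all add: p_def)
qed

lemma two_zero_permutation:
  fixes b :: "4 \<Rightarrow> int"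
  assumes "\<And>i. 2 * b i \<in> {0, sum b UNIV}" "sum b UNIV > 0"
  obtains p :: "4 \<Rightarrow> 4" and h where "bij p" "b (p 1) = 0" "b (p 2) = 0" "b (p 3) = h" "b (p 4) = h" "h > 0"
proof -
  define h where "h = sum b UNIV div 2"
  \<comment> \<open>A nonzero entry is half of the sum, so the sum is even and the division defining
    \<open>h\<close> is exact.\<close>
  obtain i where "b i \<noteq> 0" using assms(2) by (metis less_irrefl sum.neutral)
  then have "2 * b i = sum b UNIV" using assms(1)[of i] by auto
  then have h: "sum b UNIV = 2 * h"
    unfolding h_def by (metis nonzero_mult_div_cancel_left zero_neq_numeral)
  have b: "b i = 0 \<or> b i = h" for i using assms(1)[of i] h by auto
  have pos: "h > 0" using h assms(2) by simp
  have s: "b 1 + b 2 + b 3 + b 4 = 2 * h" using h by (simp add: sum_4)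
  consider "b 1 = 0" "b 2 = 0" "b 3 = h" "b 4 = h" | "b 1 = 0" "b 3 = 0" "b 2 = h" "b 4 = h"
    | "b 1 = 0" "b 4 = 0" "b 2 = h" "b 3 = h" | "b 2 = 0" "b 3 = 0" "b 1 = h" "b 4 = h"
    | "b 2 = 0" "b 4 = 0" "b 1 = h" "b 3 = h" | "b 3 = 0" "b 4 = 0" "b 1 = h" "b 2 = h"
    using b[of 1] b[of 2] b[of 3] b[of 4] s pos by (elim disjE) auto
  then have "\<exists>i j k l. distinct [i, j, k, l] \<and> b i = 0 \<and> b j = 0 \<and> b k = h \<and> b l = h"
  proof cases
    case 1 then show ?thesis by (intro exI[of _ 1] exI[of _ 2] exI[of _ 3] exI[of _ 4]) simp
  next
    case 2 then show ?thesis by (intro exI[of _ 1] exI[of _ 3] exI[of _ 2] exI[of _ 4]) simp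
  next
    case 3 then show ?thesis by (intro exI[of _ 1] exI[of _ 4] exI[of _ 2] exI[of _ 3]) simp
  next
    case 4 then show ?thesis by (intro exI[of _ 2] exI[of _ 3] exI[of _ 1] exI[of _ 4]) simp
  next
    case 5 then show ?thesis by (intro exI[of _ 2] exI[of _ 4] exI[of _ 1] exI[of _ 3]) simp
  next
    case 6 then show ?thesis by (intro exI[of _ 3] exI[of _ 4] exI[of _ 1] exI[of _ 2]) simp
  qed
  then obtain i j k l where d: "distinct [i, j, k, l]" "b i = 0" "b j = 0" "b k = h" "b l = h"
    by blast
  obtain p :: "4 \<Rightarrow> 4" where "bij p" "p 1 = i" "p 2 = j" "p 3 = k" "p 4 = l"
    using bij_four_points[OF d(1)] by blast
  with that[of p h] d pos show ?thesis by simp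
qed

lemma packing_circles_normal_form:
  fixes c :: "4 \<Rightarrow> int"
  assumes "descartes_gram W" "\<And>i. W $ i $ 2 = of_int (c i)" "sum c UNIV > 0"
    "\<And>d. (\<forall>i. d dvd c i) \<longleftrightarrow> d dvd g" "g > 0"
  obtains f t where "orthogonal_transformation f"
    "packing_circles W = (\<lambda>C. (\<lambda>z. f z + t) ` C) ` packing_circles (augmatrix (two_lines_conf (of_int g)))"
proof -
  from descartes_reduction[OF assms(1-4)] obtain V b where V: "packing_circles V = packing_circles W"
    "descartes_gram V" "\<And>i. V $ i $ 2 = of_int (b i)"
    and b: "\<And>i. 2 * b i \<in> {0, sum b UNIV}" "sum b UNIV > 0" "\<And>d. (\<forall>i. d dvd b i) \<longleftrightarrow> d dvd g"
    by blast
  obtain p :: "4 \<Rightarrow> 4" and h where p: "bij p" "b (p 1) = 0" "b (p 2) = 0" "b (p 3) = h" "b (p 4) = h" "h > 0"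
    using two_zero_permutation[OF b(1,2)] by blast
  \<comment> \<open>The common divisors of \<open>0, 0, h, h\<close> are those of \<open>h\<close>,
    and reduction preserved the common divisors, so \<open>h\<close> and \<open>g\<close> divide
    each other.\<close>
  have "(\<forall>i. d dvd b i) \<longleftrightarrow> (\<forall>i. d dvd b (p i))" for d using p(1) by (metis bij_def surjD)
  then have "(\<forall>i. d dvd b i) \<longleftrightarrow> d dvd h" for d 
    using p by (simp add: forall_4[of "\<lambda>i. d dvd b (p i)"])
  then have "h dvd g" "g dvd h" using b(3) by (metis dvd_refl)+
  then have hg: "h = g" using p(6) assms(5) by (simp add: zdvd_antisym_nonneg)
  define V' where "V' = (\<chi> i. V $ p i)"
  have "descartes_gram V'" using V(2) p(1) by (simp add: descartes_gram_def V'_def bij_def inj_eq)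
  then obtain f t where ft: "orthogonal_transformation f"
    "V' = (\<chi> i. aug_move f t (augmatrix (two_lines_conf (of_int g)) $ i))"
    by (rule two_lines_normal_form[where h = "of_int g"]) (use V(3) p hg assms(5) in \<open>simp_all add: V'_def\<close>)
  have "packing_circles W = packing_circles V'"
    using V(1) packing_circles_permute[OF p(1), of V] by (simp add: V'_def)
  with packing_circles_move[OF ft(1), of t] ft show ?thesis by (metis that)
qed

lemma geometric_super_packing_normal_form:
  assumes "is_oodc X" "integral_conf X" "conf_divisor X = g" "g > 0"
  obtains f t where "orthogonal_transformation f"
    "geometric_super_packing X = (\<lambda>C. (\<lambda>z. f z + t) ` C) ` packing_circles (augmatrix (two_lines_conf (of_int g)))"
proof -
  define c where "c i = \<lfloor>curvature X i\<rfloor>" for i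
  have c: "augmatrix X $ i $ 2 = of_int (c i)" for i
    using assms(2) by (simp add: augmatrix_curvature c_def integral_conf_def)
  have "Gcd (range c) = g" using assms(3) by (simp add: conf_divisor_def c_def)
  then have d: "(\<forall>i. d dvd c i) \<longleftrightarrow> d dvd g" for d
    by (metis (no_types, lifting) dvd_Gcd_iff ball_imageD rangeI image_iff)
  have gram: "descartes_gram (augmatrix X)" by (rule is_oodc_gram[OF assms(1)])
  \<comment> \<open>A vanishing sum makes the sum of squares vanish by the Descartes relation; then
    0 divides all curvatures and hence \<open>g\<close>.\<close>
  have "sum c UNIV \<noteq> 0"
  proof
    assume s: "sum c UNIV = 0"
    have "(\<Sum>i\<in>UNIV. (real_of_int (c i))\<^sup>2) = 0"
      using descartes_relation[OF gram] s unfolding c by (simp flip: of_int_sum)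
    then have "c i = 0" for i by (simp add: sum_nonneg_eq_0_iff)
    then show False using d[of 0] assms(4) by simp
  qed
  then consider "sum c UNIV > 0" | "sum (\<lambda>i. - c i) UNIV > 0" by (fastforce simp: sum_negf)
  then show ?thesis
  proof cases
    case 1
    then show ?thesis
      by (rule packing_circles_normal_form[OF gram c _ d assms(4)])
        (rule that, simp_all add: geometric_super_packing_eq)
  next
    \<comment> \<open>With a negative sum the argument runs on \<open>- augmatrix X\<close>, which
      has the same circles and the same divisor.\<close>
    case 2
    have "descartes_gram (- augmatrix X)" using gram by (simp add: descartes_gram_def)
    moreover have "(- augmatrix X) $ i $ 2 = of_int (- c i)" for i by (simp add: c)
    moreover have "(\<forall>i. d dvd - c i) \<longleftrightarrow> d dvd g" for d using d by simp
    ultimately show ?thesis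
      by (rule packing_circles_normal_form[OF _ _ 2 _ assms(4)])
        (rule that, simp_all add: geometric_super_packing_eq packing_circles_uminus)
  qed
qed

section \<open>Existence and uniqueness for a given divisor\<close>

theorem theorem4p1:
  fixes g :: int
  assumes "g \<ge> 1"
  shows "(\<exists>X. is_oodc X \<and> integral_conf X \<and> conf_divisor X = g) \<and>
         (\<forall>X Y. is_oodc X \<and> integral_conf X \<and> conf_divisor X = g \<and>
                is_oodc Y \<and> integral_conf Y \<and> conf_divisor Y = g \<longrightarrow>
                (\<exists>T. euclidean_motion T \<and>
                     (\<lambda>C. T ` C) ` geometric_super_packing X = geometric_super_packing Y))"
proof (intro conjI allI impI)
  let ?X = "two_lines_conf (of_int g)"
  have "curvature ?X 1 = 0" "curvature ?X 2 = 0" "curvature ?X 3 = of_int g" "curvature ?X 4 = of_int g"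
    using assms by (simp_all add: curvature_def two_lines_conf_def orient_sign_def)
  then have "integral_conf ?X" "conf_divisor ?X = g"
    using assms by (simp_all add: integral_conf_def conf_divisor_def forall_4 UNIV_4)
  moreover have "is_oodc ?X" using assms by (simp add: is_oodc_two_lines_conf)
  ultimately show "\<exists>X. is_oodc X \<and> integral_conf X \<and> conf_divisor X = g" by blast
next
  fix X Y
  assume XY: "is_oodc X \<and> integral_conf X \<and> conf_divisor X = g \<and>
    is_oodc Y \<and> integral_conf Y \<and> conf_divisor Y = g"
  have g: "g > 0" using assms by simp
  let ?P = "packing_circles (augmatrix (two_lines_conf (of_int g)))"
  obtain f t where f: "orthogonal_transformation f" and X: "geometric_super_packing X = (\<lambda>C. (\<lambda>z. f z + t) ` C) ` ?P"
    using geometric_super_packing_normal_form[of X g] XY g by metis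
  obtain k s where k: "orthogonal_transformation k" and Y: "geometric_super_packing Y = (\<lambda>C. (\<lambda>z. k z + s) ` C) ` ?P"
    using geometric_super_packing_normal_form[of Y g] XY g by metis
  \<comment> \<open>The motion sought goes back from the first packing to the normal form and then
    on to the second.\<close>
  define F where "F = inv (\<lambda>z. f z + t)"
  have F: "F (f z + t) = z" "f (F z) + t = z" for z
    using bij_move[OF f, of t] unfolding F_def
    by (simp_all add: bij_def inv_f_f[of "\<lambda>z. f z + t"] surj_f_inv_f[of "\<lambda>z. f z + t"])
  have "dist (F z) (F w) = dist z w" for z w
  proof -
    have "dist (F z) (F w) = dist (f (F z) + t) (f (F w) + t)" by (simp add: dist_move[OF f])
    then show ?thesis by (simp add: F)
  qed
  then have "euclidean_motion (\<lambda>z. k (F z) + s)"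
    by (simp add: euclidean_motion_def dist_move[OF k])
  moreover have "(\<lambda>C. (\<lambda>z. k (F z) + s) ` C) ` geometric_super_packing X = geometric_super_packing Y"
    by (simp add: X Y image_image F)
  ultimately show "\<exists>T. euclidean_motion T \<and> (\<lambda>C. T ` C) ` geometric_super_packing X = geometric_super_packing Y"
    by blast
qed

end
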